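(* For every finite connected simple graph $G$ of order $n\ge 3$, $$\operatorname{th}_{\mathrm{pzf}}(G)\ge \log_2\log_2(2n)\quad\text{and}\quad \operatorname{ept}(G)\ge\log_2\log_2(2n).$$
   Context: For a graph $G=(V,E)$, the order is $n=|V|$. Probabilistic zero forcing on $G$: each vertex is blue or white; blue vertices stay blue; in each discrete time step, if $B$ is the current set of blue vertices, each $u\in B$ independently attempts to force each of its white neighbors $v$ blue, succeeding with probability $\frac{|N[u]\cap B|}{\deg u}$, where $N[u]$ is the closed neighborhood of $u$ (all attempts in a step are independent; a white vertex becomes blue if at least one attempt on it succeeds). For a nonempty $S\subseteq V$, $\operatorname{ept}(G,S)$ is the expected number of steps until all vertices are blue when exactly $S$ is initially blue, and $\operatorname{ept}(G)=\min_{v\in V}\operatorname{ept}(G,\{v\})$. The probabilistic throttling number is $\operatorname{th}_{\mathrm{pzf}}(G)=\min_{\emptyset\ne S\subseteq V}\left(|S|+\operatorname{ept}(G,S)\right)$. *)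

theory Defs
  imports "HOL-Probability.Probability" "Graph_Theory.Graph_Theory"
begin

text \<open>
  A finite simple graph is a \<^locale>\<open>pair_graph\<close>: a finite loop-free symmetric set of arcs on a
  finite vertex set, so each undirected edge is a pair of opposite arcs and the degree of a vertex
  is its out-degree.
\<close>

definition closed_nbhd :: "'a pair_pre_digraph \<Rightarrow> 'a \<Rightarrow> 'a set" where
  "closed_nbhd G u = insert u {v. (u, v) \<in> parcs G}"

definition force_prob :: "'a pair_pre_digraph \<Rightarrow> 'a set \<Rightarrow> 'a \<Rightarrow> real" where
  "force_prob G B u = real (card (closed_nbhd G u \<inter> B)) / real (out_degree (with_proj G) u)"

text \<open>The pairs \<open>(u, v)\<close> such that the blue vertex \<open>u\<close> attempts to force the white vertex \<open>v\<close>.\<close>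

definition attempts :: "'a pair_pre_digraph \<Rightarrow> 'a set \<Rightarrow> ('a \<times> 'a) set" where
  "attempts G B = {(u, v) \<in> parcs G. u \<in> B \<and> v \<notin> B}"

text \<open>
  \<^const>\<open>bernoulli_pmf\<close> truncates its parameter to the unit interval; for the pairs in
  \<^const>\<open>attempts\<close> this has no effect, see \<open>force_prob_le_1\<close> below.
\<close>

definition pzf_step :: "'a pair_pre_digraph \<Rightarrow> 'a set \<Rightarrow> 'a set pmf" where
  "pzf_step G B =
     map_pmf (\<lambda>success. B \<union> {v. \<exists>u. (u, v) \<in> attempts G B \<and> success (u, v)})
       (Pi_pmf (attempts G B) False (\<lambda>(u, v). bernoulli_pmf (force_prob G B u)))"

text \<open>
  The law of the Markov chain of blue sets started in \<open>S\<close>, as a measure on trajectories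
  \<open>nat \<Rightarrow> 'a set\<close>. The state at time \<open>t\<close> is drawn from a kernel depending on the history
  \<open>h\<close> of the states at times \<open>0, \<dots>, t - 1\<close>; the Ionescu-Tulcea construction combines the kernels.
\<close>

definition pzf_kernel :: "'a pair_pre_digraph \<Rightarrow> 'a set \<Rightarrow> nat \<Rightarrow> (nat \<Rightarrow> 'a set) \<Rightarrow> 'a set measure" where
  "pzf_kernel G S t h = measure_pmf (if t = 0 then return_pmf S else pzf_step G (h (t - 1)))"

definition pzf_process :: "'a pair_pre_digraph \<Rightarrow> 'a set \<Rightarrow> (nat \<Rightarrow> 'a set) measure" where
  "pzf_process G S =
     projective_family.lim UNIV
       (Ionescu_Tulcea.CI (pzf_kernel G S) (\<lambda>_. count_space UNIV)) (\<lambda>_. count_space UNIV)"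

text \<open>The value is \<open>\<infinity>\<close> on trajectories that never turn completely blue.\<close>

definition propagation_time :: "'a pair_pre_digraph \<Rightarrow> (nat \<Rightarrow> 'a set) \<Rightarrow> ennreal" where
  "propagation_time G \<omega> = (INF t\<in>{t. \<omega> t = pverts G}. of_nat t)"

definition ept_set :: "'a pair_pre_digraph \<Rightarrow> 'a set \<Rightarrow> ennreal" where
  "ept_set G S = (\<integral>\<^sup>+ \<omega>. propagation_time G \<omega> \<partial>pzf_process G S)"

definition ept :: "'a pair_pre_digraph \<Rightarrow> ennreal" where
  "ept G = Min ((\<lambda>v. ept_set G {v}) ` pverts G)"

definition th_pzf :: "'a pair_pre_digraph \<Rightarrow> ennreal" where
  "th_pzf G = Min ((\<lambda>S. of_nat (card S) + ept_set G S) ` {S. S \<subseteq> pverts G \<and> S \<noteq> {}})"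

lemma force_prob_nonneg: "0 \<le> force_prob G B u"
  by (simp add: force_prob_def)

lemma (in pair_graph) force_prob_le_1:
  assumes "(u, v) \<in> attempts G B"
  shows "force_prob G B u \<le> 1"
proof -
  let ?N = "{v. (u, v) \<in> parcs G}"
  have arc: "(u, v) \<in> parcs G" "v \<notin> B" using assms by (auto simp: attempts_def)
  have eq: "out_arcs (with_proj G) u = Pair u ` ?N" by auto
  have deg: "out_degree (with_proj G) u = card ?N"
    unfolding out_degree_def eq by (rule card_image) (simp add: inj_on_def)
  have fin: "finite ?N"
    by (rule finite_subset[OF _ finite_imageI[OF pair_finite_arcs, of snd]]) force
  have "card (closed_nbhd G u \<inter> B) \<le> card (insert u (?N - {v}))"
    using fin arc by (intro card_mono) (auto simp: closed_nbhd_def)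
  also have "\<dots> \<le> Suc (card (?N - {v}))"
    by (rule card_insert_le_m1) auto
  also have "\<dots> = card ?N"
    using fin arc by (intro card_Suc_Diff1) auto
  finally show ?thesis by (auto simp: force_prob_def deg divide_le_eq)
qed

lemma Ionescu_Tulcea_pzf_kernel:
  fixes G :: "'a pair_pre_digraph"
  shows "Ionescu_Tulcea (pzf_kernel G S) (\<lambda>_. count_space UNIV)"
proof (rule Ionescu_Tulcea.intro)
  fix t
  show "pzf_kernel G S t \<in> measurable (PiM {0..<t} (\<lambda>_. count_space UNIV)) (subprob_algebra (count_space UNIV))"
  proof (cases "t = 0")
    case True
    then show ?thesis
      by (auto simp: pzf_kernel_def[abs_def] intro!: measurable_const measure_pmf_in_subprob_algebra)
  next
    case False
    have "(\<lambda>h. h (t - 1)) \<in> measurable (PiM {0..<t} (\<lambda>_. count_space UNIV)) (count_space UNIV)"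
      by (rule measurable_component_singleton) (use False in auto)
    moreover have "(\<lambda>B. measure_pmf (pzf_step G B)) \<in>
        measurable (count_space UNIV) (subprob_algebra (count_space UNIV))"
      by (simp add: measure_pmf_in_subprob_algebra)
    ultimately show ?thesis
      using False by (auto simp: pzf_kernel_def[abs_def] intro: measurable_compose)
  qed
next
  fix t and h :: "nat \<Rightarrow> 'a set"
  show "prob_space (pzf_kernel G S t h)"
    unfolding pzf_kernel_def by (rule measure_pmf.prob_space_axioms)
qed

lemma sets_pzf_process: "sets (pzf_process G S) = sets (PiM UNIV (\<lambda>_. count_space UNIV))"
proof -
  interpret Ionescu_Tulcea "pzf_kernel G S" "\<lambda>_. count_space UNIV"
    by (rule Ionescu_Tulcea_pzf_kernel)
  show ?thesis unfolding pzf_process_def by (rule PF.sets_lim)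
qed

lemma prob_space_pzf_process: "prob_space (pzf_process G S)"
proof -
  interpret Ionescu_Tulcea "pzf_kernel G S" "\<lambda>_. count_space UNIV"
    by (rule Ionescu_Tulcea_pzf_kernel)
  interpret CI: prob_space "CI {}"
    by (rule PF.prob_space_P) auto
  have "emeasure PF.lim (PF.emb UNIV {} (space (PiM {} (\<lambda>_. count_space UNIV)))) = emeasure (CI {}) (space (PiM {} (\<lambda>_. count_space UNIV)))"
    by (rule lim) auto
  also have "\<dots> = 1"
    using CI.emeasure_space_1 by (simp add: CI_def)
  also have "PF.emb UNIV {} (space (PiM {} (\<lambda>_. count_space UNIV))) = UNIV"
    by (auto simp: prod_emb_def space_PiM)
  finally have "emeasure PF.lim UNIV = 1" .
  then show ?thesis
    unfolding pzf_process_def by (intro prob_spaceI) (simp add: space_PiM)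
qed

lemma measurable_propagation_time [measurable]:
  "propagation_time G \<in> borel_measurable (pzf_process G S)"
proof -
  have eq: "propagation_time G = (\<lambda>\<omega>. INF t. if \<omega> t = pverts G then of_nat t else \<infinity>)"
    (is "_ = ?g")
  proof
    fix \<omega>
    show "propagation_time G \<omega> = ?g \<omega>"
      unfolding propagation_time_def
    proof (rule antisym)
      show "(INF t\<in>{t. \<omega> t = pverts G}. of_nat t) \<le> ?g \<omega>"
        by (rule INF_greatest) (auto intro: INF_lower)
      show "?g \<omega> \<le> (INF t\<in>{t. \<omega> t = pverts G}. of_nat t)"
      proof (rule INF_greatest)
        fix t assume "t \<in> {t. \<omega> t = pverts G}"
        then show "?g \<omega> \<le> of_nat t"
          by (intro INF_lower2[of t]) simp_all
      qed
    qed
  qed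
  have comp: "(\<lambda>\<omega>. \<omega> t) \<in> measurable (pzf_process G S) (count_space UNIV)" for t
    using measurable_component_singleton[of t UNIV "\<lambda>_. count_space UNIV"]
    by (simp add: measurable_cong_sets[OF sets_pzf_process refl])
  have "(\<lambda>\<omega>. if \<omega> t = pverts G then of_nat t else \<infinity> :: ennreal) \<in> borel_measurable (pzf_process G S)" for t
    by (rule measurable_compose[OF comp]) simp
  then show ?thesis unfolding eq by (intro borel_measurable_INF) auto
qed

end

theory Submission
  imports Defs
begin

text \<open>
  With \<open>b\<close> blue vertices, each blue \<open>u\<close> of degree \<open>d\<close> makes at most \<open>d\<close> attempts, each succeeding
  with probability at most \<open>b / d\<close>, so the expected number of blue vertices after one step is at
  most \<open>b + b\<^sup>2 \<le> 2 * b\<^sup>2\<close>. For the concave function \<open>f x = log 2 (log 2 (2 * x))\<close>, which satisfies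
  \<open>f (2 * x\<^sup>2) = f x + 1\<close>, Jensen's inequality shows that \<open>f\<close> of the number of blue vertices grows
  by at most 1 per step in expectation. Summing over time up to propagation gives
  \<open>f n - f (card S) \<le> ept(G, S)\<close>, and \<open>f 1 = 0\<close>, \<open>f s \<le> s\<close> yield both bounds.
\<close>

section \<open>Integrals over trajectories and the Markov property\<close>

text \<open>The projective limit is known through its values on cylinder sets. For a cylinder over
  the initial segment \<open>{0..<n}\<close>, \<open>CI\<close> reduces to the iterated kernel
  \<open>C 0 n\<close>, because the embedding of that segment into itself is the identity.\<close>

lemma (in Ionescu_Tulcea) distr_lim_restrict:
  "distr PF.lim (PiM {0..<n} M) (\<lambda>\<omega>. restrict \<omega> {0..<n}) = C 0 n (\<lambda>_. undefined)"
proof (rule measure_eqI)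
  \<comment> \<open>The empty history: the only point of the product over the empty index set
    \<open>{0..<0}\<close>.\<close>
  have start: "(\<lambda>_. undefined) \<in> space (PiM {0..<0} M)"
    by (simp add: space_PiM)
  show "sets (distr PF.lim (PiM {0..<n} M) (\<lambda>\<omega>. restrict \<omega> {0..<n})) = sets (C 0 n (\<lambda>_. undefined))"
    using sets_C[OF start, of n] by simp
  fix A assume "A \<in> sets (distr PF.lim (PiM {0..<n} M) (\<lambda>\<omega>. restrict \<omega> {0..<n}))"
  then have A: "A \<in> sets (PiM {0..<n} M)" by simp
  have "emeasure (distr PF.lim (PiM {0..<n} M) (\<lambda>\<omega>. restrict \<omega> {0..<n})) A
      = emeasure PF.lim (PF.emb UNIV {0..<n} A)"
    using A by (intro emeasure_distr_restrict) (simp_all add: PF.sets_lim)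
  also have "\<dots> = emeasure (CI {0..<n}) A"
    using A by (intro lim) auto
  also have "\<dots> = emeasure (C 0 n (\<lambda>_. undefined)) (PF.emb {0..<n} {0..<n} A)"
    using A by (intro emeasure_CI) auto
  also have "PF.emb {0..<n} {0..<n} A = A"
    using sets.sets_into_space[OF A] by (intro prod_emb_id) (simp add: space_PiM)
  finally show "emeasure (distr PF.lim (PiM {0..<n} M) (\<lambda>\<omega>. restrict \<omega> {0..<n})) A
      = emeasure (C 0 n (\<lambda>_. undefined)) A" .
qed

text \<open>\<open>C 0 (Suc n)\<close> is \<open>C 0 n\<close> bound to the extension kernel
  \<open>eP n\<close>, so the last coordinate can be integrated first, conditionally on the history
  before it.\<close>

lemma (in Ionescu_Tulcea) nn_integral_lim_Suc:
  assumes f: "f \<in> borel_measurable (PiM {0..<Suc n} M)"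
  shows "(\<integral>\<^sup>+\<omega>. f (restrict \<omega> {0..<Suc n}) \<partial>PF.lim) =
    (\<integral>\<^sup>+\<omega>. (\<integral>\<^sup>+x. f ((restrict \<omega> {0..<n})(n := x)) \<partial>P n (restrict \<omega> {0..<n})) \<partial>PF.lim)"
proof -
  have start: "(\<lambda>_. undefined) \<in> space (PiM {0..<0} M)"
    by (simp add: space_PiM)
  have restr: "(\<lambda>\<omega>. restrict \<omega> {0..<k}) \<in> measurable PF.lim (PiM {0..<k} M)" for k
    by (subst measurable_cong_sets[OF PF.sets_lim refl]) (auto intro: measurable_restrict_subset)
  have inner: "(\<lambda>h. \<integral>\<^sup>+x. f x \<partial>eP n h) \<in> borel_measurable (PiM {0..<n} M)"
    by (rule nn_integral_measurable_subprob_algebra2[OF _ measurable_eP]) (use f in measurable)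
  have "(\<integral>\<^sup>+\<omega>. f (restrict \<omega> {0..<Suc n}) \<partial>PF.lim) = (\<integral>\<^sup>+h. f h \<partial>C 0 (Suc n) (\<lambda>_. undefined))"
    unfolding distr_lim_restrict[symmetric] by (subst nn_integral_distr[OF restr]) (use f in auto)
  also have "\<dots> = (\<integral>\<^sup>+h. (\<integral>\<^sup>+x. f x \<partial>eP n h) \<partial>C 0 n (\<lambda>_. undefined))"
    unfolding C.simps add_0
    by (rule nn_integral_bind[OF f])
      (simp add: measurable_cong_sets[OF sets_C[OF start, of n, unfolded add_0] refl])
  also have "\<dots> = (\<integral>\<^sup>+\<omega>. (\<integral>\<^sup>+x. f x \<partial>eP n (restrict \<omega> {0..<n})) \<partial>PF.lim)"
    unfolding distr_lim_restrict[symmetric] by (subst nn_integral_distr[OF restr]) (use inner in auto)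
  also have "\<dots> = (\<integral>\<^sup>+\<omega>. (\<integral>\<^sup>+x. f ((restrict \<omega> {0..<n})(n := x)) \<partial>P n (restrict \<omega> {0..<n})) \<partial>PF.lim)"
    using measurable_space[OF restr] by (intro nn_integral_cong nn_integral_eP f) auto
  finally show ?thesis .
qed

text \<open>The Markov property: the kernel at time \<open>Suc n\<close> reads only the last state
  of the history. The factor \<open>h\<close> allows restriction to an event about the current
  state; \<open>h = 1\<close> gives the plain one-step expectation.\<close>

lemma nn_integral_pzf_process_Suc:
  fixes g h :: "'a set \<Rightarrow> ennreal"
  shows "(\<integral>\<^sup>+\<omega>. h (\<omega> n) * g (\<omega> (Suc n)) \<partial>pzf_process G S) =
    (\<integral>\<^sup>+\<omega>. h (\<omega> n) * (\<integral>\<^sup>+B. g B \<partial>pzf_step G (\<omega> n)) \<partial>pzf_process G S)"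
proof -
  have comp: "(\<lambda>\<omega>. k (\<omega> i)) \<in> borel_measurable (PiM {0..<Suc (Suc n)} (\<lambda>_. count_space UNIV))"
    if "i \<le> Suc n" for i and k :: "'a set \<Rightarrow> ennreal"
    by (rule measurable_compose[OF measurable_component_singleton]) (use that in auto)
  have "(\<lambda>\<omega>. h (\<omega> n) * g (\<omega> (Suc n))) \<in> borel_measurable (PiM {0..<Suc (Suc n)} (\<lambda>_. count_space UNIV))"
    using comp by (intro borel_measurable_times_ennreal) auto
  from Ionescu_Tulcea.nn_integral_lim_Suc[OF Ionescu_Tulcea_pzf_kernel this] show ?thesis
    by (simp add: pzf_process_def pzf_kernel_def nn_integral_cmult)
qed

lemma nn_integral_pzf_process_0:
  "(\<integral>\<^sup>+\<omega>. g (\<omega> 0) \<partial>pzf_process G S) = g S"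
proof -
  have "(\<lambda>\<omega>. g (\<omega> 0)) \<in> borel_measurable (PiM {0..<Suc 0} (\<lambda>_. count_space UNIV))"
    by (rule measurable_compose[OF measurable_component_singleton]) auto
  from Ionescu_Tulcea.nn_integral_lim_Suc[OF Ionescu_Tulcea_pzf_kernel this] show ?thesis
    using prob_space.emeasure_space_1[OF prob_space_pzf_process, of G S]
    by (simp add: pzf_process_def[symmetric] pzf_kernel_def)
qed

lemma measurable_pzf_process_component [measurable]:
  "(\<lambda>\<omega>. \<omega> t) \<in> measurable (pzf_process G S) (count_space UNIV)"
  using measurable_component_singleton[of t UNIV "\<lambda>_. count_space UNIV"]
  by (simp add: measurable_cong_sets[OF sets_pzf_process refl])

lemma borel_measurable_pzf_process_component:
  fixes k :: "'a set \<Rightarrow> ennreal"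
  shows "(\<lambda>\<omega>. k (\<omega> t)) \<in> borel_measurable (pzf_process G S)"
  by (rule measurable_compose[OF measurable_pzf_process_component]) simp

text \<open>Lifts a statement about the support of one step to almost all trajectories: the
  probability of being in \<open>X\<close> and then missing \<open>Y\<close> is an integral of
  zeros. It serves both for invariance of a class of states and for absorption in the fully blue
  state.\<close>

lemma AE_pzf_process_Suc:
  assumes "AE \<omega> in pzf_process G S. \<omega> n \<in> X \<longrightarrow> set_pmf (pzf_step G (\<omega> n)) \<subseteq> Y"
  shows "AE \<omega> in pzf_process G S. \<omega> n \<in> X \<longrightarrow> \<omega> (Suc n) \<in> Y"
proof -
  have "(\<integral>\<^sup>+\<omega>. indicator X (\<omega> n) * indicator (- Y) (\<omega> (Suc n)) \<partial>pzf_process G S) =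
      (\<integral>\<^sup>+\<omega>. indicator X (\<omega> n) * emeasure (pzf_step G (\<omega> n)) (- Y) \<partial>pzf_process G S)"
    by (simp add: nn_integral_pzf_process_Suc)
  also have "\<dots> = (\<integral>\<^sup>+\<omega>. 0 \<partial>pzf_process G S)"
  proof (rule nn_integral_cong_AE, use assms in eventually_elim)
    fix \<omega> assume "\<omega> n \<in> X \<longrightarrow> set_pmf (pzf_step G (\<omega> n)) \<subseteq> Y"
    then have "emeasure (pzf_step G (\<omega> n)) (- Y) = 0" if "\<omega> n \<in> X"
      using that by (auto simp: measure_pmf.emeasure_eq_measure measure_pmf_zero_iff)
    then show "indicator X (\<omega> n) * emeasure (pzf_step G (\<omega> n)) (- Y) = 0"
      by (auto split: split_indicator)
  qed
  finally have "(\<integral>\<^sup>+\<omega>. indicator X (\<omega> n) * indicator (- Y) (\<omega> (Suc n)) \<partial>pzf_process G S) = 0"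
    by simp
  then have "AE \<omega> in pzf_process G S.
      indicator X (\<omega> n) * indicator (- Y) (\<omega> (Suc n)) = (0 :: ennreal)"
    by (subst (asm) nn_integral_0_iff_AE)
      (intro borel_measurable_times_ennreal borel_measurable_pzf_process_component)
  then show ?thesis
    by eventually_elim (auto split: split_indicator_asm)
qed

section \<open>The iterated logarithm: growth and concavity\<close>

definition loglog :: "real \<Rightarrow> real" where
  "loglog x = log 2 (log 2 (2 * x))"

lemma log2_double_ge_1: "1 \<le> x \<Longrightarrow> 1 \<le> log 2 (2 * x)"
  by (simp add: le_log_iff)

lemma loglog_1 [simp]: "loglog 1 = 0"
  by (simp add: loglog_def)

lemma loglog_nonneg: "1 \<le> x \<Longrightarrow> 0 \<le> loglog x"
  using log2_double_ge_1[of x] by (simp add: loglog_def)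

lemma loglog_mono: "1 \<le> x \<Longrightarrow> x \<le> y \<Longrightarrow> loglog x \<le> loglog y"
  using log2_double_ge_1[of x] by (simp add: loglog_def)

text \<open>Since \<open>2 * (2 * x\<^sup>2) = (2 * x)\<^sup>2\<close>, the inner logarithm doubles,
  and the outer one turns the doubling into \<open>+ 1\<close>.\<close>

lemma loglog_double_square:
  assumes "1 \<le> x"
  shows "loglog (2 * x\<^sup>2) = loglog x + 1"
proof -
  have "log 2 (2 * (2 * x\<^sup>2)) = log 2 ((2 * x)\<^sup>2)"
    by (simp add: power_mult_distrib)
  also have "\<dots> = 2 * log 2 (2 * x)"
    using assms by (subst log_nat_power) auto
  finally show ?thesis
    using log2_double_ge_1[OF assms] by (simp add: loglog_def log_mult)
qed

text \<open>Rests on \<open>2 * s \<le> 2 ^ s\<close>. In the throttling bound the cost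
  \<open>card S\<close> of the initial set thereby pays for its head start
  \<open>loglog (card S)\<close>.\<close>

lemma loglog_le_self:
  assumes "1 \<le> s"
  shows "loglog (real s) \<le> real s"
proof -
  obtain k where k: "s = Suc k"
    using assms by (cases s) auto
  have "Suc k \<le> 2 ^ k"
    by (rule Suc_leI) (rule less_exp)
  then have "real (2 * s) \<le> real (2 ^ s)"
    unfolding k of_nat_le_iff by simp
  then have "2 * real s \<le> 2 powr real s"
    by (simp add: powr_realpow)
  then have le: "log 2 (2 * real s) \<le> real s"
    using assms by (simp add: log_le_iff)
  then have "loglog (real s) \<le> log 2 (real s)"
    using log2_double_ge_1[of "real s"] assms by (simp add: loglog_def)
  also have "\<dots> \<le> log 2 (2 * real s)"
    using assms by simp
  finally show ?thesis
    using le by simp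
qed

text \<open>This is \<open>ln t \<le> t - 1\<close> at \<open>t = u / v\<close>, rescaled to base
  2.\<close>

lemma log2_tangent:
  assumes "0 < u" "0 < v"
  shows "log 2 u \<le> log 2 v + (u - v) / (v * ln 2)"
proof -
  have "ln u - ln v = ln (u / v)"
    using assms by (simp add: ln_div)
  also have "\<dots> \<le> u / v - 1"
    using assms by (intro ln_le_minus_one) simp
  also have "\<dots> = (u - v) / v"
    using assms by (simp add: field_simps)
  finally have "(ln u - ln v) / ln 2 \<le> (u - v) / v / ln 2"
    by (intro divide_right_mono) auto
  moreover have "(ln u - ln v) / ln 2 = log 2 u - log 2 v"
    by (simp add: log_def diff_divide_distrib)
  ultimately show ?thesis
    by simp
qed

text \<open>The tangent-line form of concavity, from which Jensen's inequality follows by integration.\<close>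

lemma loglog_tangent:
  assumes "1 \<le> x"
  obtains c where "0 \<le> c" "\<And>y. 1 \<le> y \<Longrightarrow> loglog y \<le> loglog x + c * (y - x)"
proof
  let ?L = "\<lambda>y. log 2 (2 * y)"
  \<comment> \<open>The derivative of \<open>loglog\<close> at \<open>x\<close> by the chain rule.
    The tangent bound is applied to the outer and then to the inner logarithm; the outer slope is
    nonnegative, so the two bounds compose.\<close>
  let ?c = "1 / (?L x * ln 2) * (1 / (x * ln 2))"
  have x: "1 \<le> ?L x"
    using assms by (rule log2_double_ge_1)
  show "0 \<le> ?c"
    using x assms by simp
  fix y :: real assume y: "1 \<le> y"
  have "loglog y \<le> loglog x + 1 / (?L x * ln 2) * (?L y - ?L x)"
    using log2_tangent[of "?L y" "?L x"] log2_double_ge_1[OF y] x by (simp add: loglog_def)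
  also have "?L y - ?L x \<le> 1 / (x * ln 2) * (y - x)"
    using log2_tangent[of y x] y assms by (simp add: log_mult)
  then have "1 / (?L x * ln 2) * (?L y - ?L x) \<le> ?c * (y - x)"
    using x by (subst mult.assoc) (intro mult_left_mono, auto)
  finally show "loglog y \<le> loglog x + ?c * (y - x)"
    by simp
qed

section \<open>One step of the forcing process\<close>

lemma (in pair_graph) finite_attempts: "finite (attempts G B)"
  by (rule finite_subset[OF _ pair_finite_arcs]) (auto simp: attempts_def)

lemma (in pair_graph) set_pmf_pzf_step: "set_pmf (pzf_step G B) \<subseteq> {B'. B \<subseteq> B' \<and> B' \<subseteq> B \<union> pverts G}"
  by (auto simp: pzf_step_def attempts_def dest: in_arcsD2)

lemma (in pair_graph) finite_set_pmf_pzf_step: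
  assumes "B \<subseteq> pverts G"
  shows "finite (set_pmf (pzf_step G B))"
  by (rule finite_subset[of _ "Pow (pverts G)"]) (use set_pmf_pzf_step[of B] assms in auto)

text \<open>For a fixed blue \<open>u\<close>, the number of white neighbors is at most the degree,
  which cancels the denominator of \<open>force_prob\<close> and leaves at most
  \<open>card B\<close>. Summing over \<open>u\<close> gives the square.\<close>

lemma (in pair_graph) sum_force_prob_le:
  assumes "finite B"
  shows "(\<Sum>(u, v)\<in>attempts G B. force_prob G B u) \<le> (real (card B))\<^sup>2"
proof -
  let ?W = "\<lambda>u. {v. (u, v) \<in> parcs G \<and> v \<notin> B}"
  have fin: "finite (?W u)" for u
    by (rule finite_subset[OF _ finite_imageI[OF pair_finite_arcs, of snd]]) force
  have "attempts G B = Sigma B ?W"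
    by (auto simp: attempts_def)
  then have "(\<Sum>(u, v)\<in>attempts G B. force_prob G B u) = (\<Sum>u\<in>B. \<Sum>v\<in>?W u. force_prob G B u)"
    using assms fin by (subst sum.Sigma) auto
  also have "\<dots> \<le> (\<Sum>u\<in>B. real (card B))"
  proof (rule sum_mono)
    fix u assume "u \<in> B"
    have "card (?W u) = card (Pair u ` ?W u)"
      by (rule card_image[symmetric]) (simp add: inj_on_def)
    also have "\<dots> \<le> out_degree (with_proj G) u"
      unfolding out_degree_def
      by (rule card_mono) (auto intro: finite_subset[OF _ pair_finite_arcs])
    \<comment> \<open>For degree 0 the quotient is 0 by the convention on division.\<close>
    finally have "real (card (?W u)) / real (out_degree (with_proj G) u) \<le> 1"
      by (auto simp: divide_le_eq)
    moreover have "card (closed_nbhd G u \<inter> B) \<le> card B"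
      using assms by (intro card_mono) auto
    ultimately have "real (card (?W u)) / real (out_degree (with_proj G) u) * real (card (closed_nbhd G u \<inter> B))
        \<le> 1 * real (card B)"
      by (intro mult_mono) auto
    then show "(\<Sum>v\<in>?W u. force_prob G B u) \<le> real (card B)"
      by (simp add: force_prob_def)
  qed
  finally show ?thesis
    by (simp add: power2_eq_square)
qed

text \<open>A vertex forced several times turns blue only once, so the number of new blue vertices
  is at most the number of successful forces, whose mean follows by linearity of
  expectation.\<close>

lemma (in pair_graph) expectation_card_pzf_step:
  assumes "B \<subseteq> pverts G"
  shows "measure_pmf.expectation (pzf_step G B) (\<lambda>B'. real (card B')) \<le> real (card B) + (real (card B))\<^sup>2"
proof -
  let ?A = "attempts G B"
  let ?p = "Pi_pmf ?A False (\<lambda>(u, v). bernoulli_pmf (force_prob G B u))"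
  have fin: "finite (set_pmf ?p)"
    by (subst set_Pi_pmf[OF finite_attempts]) (auto intro!: finite_PiE_dflt finite_attempts)
  have int: "integrable (measure_pmf ?p) X" for X :: "_ \<Rightarrow> real"
    by (rule integrable_measure_pmf_finite[OF fin])
  have "measure_pmf.expectation (pzf_step G B) (\<lambda>B'. real (card B'))
      \<le> measure_pmf.expectation ?p (\<lambda>s. real (card B) + (\<Sum>e\<in>?A. of_bool (s e)))"
    unfolding pzf_step_def integral_map_pmf
  proof (intro integral_mono int)
    fix s :: "'a \<times> 'a \<Rightarrow> bool"
    have "{v. \<exists>u. (u, v) \<in> ?A \<and> s (u, v)} = snd ` {e \<in> ?A. s e}"
      by force
    then have "card (B \<union> {v. \<exists>u. (u, v) \<in> ?A \<and> s (u, v)}) \<le> card B + card (snd ` {e \<in> ?A. s e})"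
      by (simp add: card_Un_le)
    also have "card (snd ` {e \<in> ?A. s e}) \<le> card {e \<in> ?A. s e}"
      using finite_attempts by (intro card_image_le) auto
    also have "\<dots> = (\<Sum>e\<in>?A. of_bool (s e))"
      using finite_attempts[of B] by (simp add: of_bool_def sum.If_cases Int_def)
    finally have "real (card (B \<union> {v. \<exists>u. (u, v) \<in> ?A \<and> s (u, v)})) \<le> real (card B + (\<Sum>e\<in>?A. of_bool (s e)))"
      by (simp only: of_nat_le_iff)
    then show "real (card (B \<union> {v. \<exists>u. (u, v) \<in> ?A \<and> s (u, v)})) \<le> real (card B) + (\<Sum>e\<in>?A. of_bool (s e))"
      by simp
  qed
  also have "\<dots> = real (card B) + (\<Sum>e\<in>?A. measure_pmf.expectation ?p (\<lambda>s. of_bool (s e)))"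
    by (simp add: int)
  also have "(\<Sum>e\<in>?A. measure_pmf.expectation ?p (\<lambda>s. of_bool (s e))) = (\<Sum>(u, v)\<in>?A. force_prob G B u)"
  proof (rule sum.cong[OF refl], clarify)
    fix u v assume uv: "(u, v) \<in> ?A"
    have "measure_pmf.expectation ?p (\<lambda>s. of_bool (s (u, v)) :: real)
        = measure_pmf.expectation (map_pmf (\<lambda>s. s (u, v)) ?p) of_bool"
      by simp
    also have "\<dots> = measure_pmf.expectation (bernoulli_pmf (force_prob G B u)) of_bool"
      using uv by (subst Pi_pmf_component[OF finite_attempts]) simp
    \<comment> \<open>The parameter lies in the unit interval here, so truncation does not change it
      and it is the mean.\<close>
    also have "\<dots> = force_prob G B u"
      using force_prob_nonneg force_prob_le_1[OF uv] by (subst integral_bernoulli_pmf) auto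
    finally show "measure_pmf.expectation ?p (\<lambda>s. of_bool (s (u, v))) = force_prob G B u" .
  qed
  finally show ?thesis
    using sum_force_prob_le[OF finite_subset[OF assms]] by simp
qed

lemma (in pair_graph) expectation_loglog_pzf_step:
  assumes "B \<subseteq> pverts G" "B \<noteq> {}"
  shows "measure_pmf.expectation (pzf_step G B) (\<lambda>B'. loglog (real (card B'))) \<le> loglog (real (card B)) + 1"
proof -
  have int: "integrable (measure_pmf (pzf_step G B)) X" for X :: "_ \<Rightarrow> real"
    by (rule integrable_measure_pmf_finite[OF finite_set_pmf_pzf_step[OF assms(1)]])
  have card_ge: "1 \<le> real (card B')" if "B' \<noteq> {}" "B' \<subseteq> pverts G" for B'
    using that finite_subset[OF that(2)] by (simp add: Suc_le_eq card_gt_0_iff)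
  let ?b = "real (card B)"
  have b: "1 \<le> ?b"
    using assms by (intro card_ge) auto
  then have sq: "?b \<le> ?b\<^sup>2"
    by (simp add: power2_eq_square)
  obtain c where c: "0 \<le> c" "\<And>y. 1 \<le> y \<Longrightarrow> loglog y \<le> loglog (2 * ?b\<^sup>2) + c * (y - 2 * ?b\<^sup>2)"
    using loglog_tangent[of "2 * ?b\<^sup>2"] b sq by auto
  have "measure_pmf.expectation (pzf_step G B) (\<lambda>B'. loglog (real (card B')))
      \<le> measure_pmf.expectation (pzf_step G B) (\<lambda>B'. loglog (2 * ?b\<^sup>2) + c * (real (card B') - 2 * ?b\<^sup>2))"
  proof (intro integral_mono_AE int, unfold AE_measure_pmf_iff, intro ballI c)
    fix B' assume "B' \<in> set_pmf (pzf_step G B)"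
    then show "1 \<le> real (card B')"
      using set_pmf_pzf_step[of B] assms by (intro card_ge) auto
  qed
  also have "\<dots> = loglog (2 * ?b\<^sup>2) +
      c * (measure_pmf.expectation (pzf_step G B) (\<lambda>B'. real (card B')) - 2 * ?b\<^sup>2)"
    by (simp add: int)
  also have "\<dots> \<le> loglog (2 * ?b\<^sup>2) + c * 0"
  proof (intro add_left_mono mult_left_mono c(1))
    show "measure_pmf.expectation (pzf_step G B) (\<lambda>B'. real (card B')) - 2 * ?b\<^sup>2 \<le> 0"
      using expectation_card_pzf_step[OF assms(1)] sq by linarith
  qed
  also have "\<dots> = loglog ?b + 1"
    using loglog_double_square[OF b] by simp
  finally show ?thesis .
qed

section \<open>From one-step drift to expected propagation time\<close>

text \<open>A potential argument: telescoping the drift up to time \<open>m\<close> bounds the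
  initial deficit by the expected number of unfinished times before \<open>m\<close> plus the
  expected deficit at \<open>m\<close>. If the expected time is finite, the latter vanishes as
  \<open>m\<close> grows.\<close>

lemma (in pair_graph) ept_set_ge:
  assumes S: "S \<subseteq> pverts G" "S \<noteq> {}"
  shows "ennreal (loglog (real (card (pverts G))) - loglog (real (card S))) \<le> ept_set G S"
proof (cases "ept_set G S = \<infinity>")
  case True
  then show ?thesis by simp
next
  case False
  let ?V = "pverts G"
  let ?n = "real (card ?V)"
  let ?I = "{B. B \<subseteq> ?V \<and> B \<noteq> {}}"
  \<comment> \<open>The deficit replaces \<open>loglog\<close> itself because it is nonnegative on
    \<open>?I\<close>, as nonnegative integrals require, and zero at \<open>?V\<close>.\<close>
  define \<phi> where "\<phi> B = loglog ?n - loglog (real (card B))" for B :: "'a set"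
  \<comment> \<open>The probability that propagation is unfinished at time \<open>t\<close>.\<close>
  define p where "p t = (\<integral>\<^sup>+\<omega>. indicator (- {?V}) (\<omega> t) \<partial>pzf_process G S)" for t

  have card_ge: "1 \<le> real (card B)" "real (card B) \<le> ?n" if "B \<in> ?I" for B
    using that finite_subset[of B ?V] by (auto simp: Suc_le_eq card_gt_0_iff card_mono)
  have \<phi>_nonneg: "0 \<le> \<phi> B" and \<phi>_le: "\<phi> B \<le> loglog ?n * indicator (- {?V}) B" if "B \<in> ?I" for B
    using loglog_mono[OF card_ge[OF that]] loglog_nonneg[OF card_ge(1)[OF that]]
    by (auto simp: \<phi>_def split: split_indicator)
  have invariant: "set_pmf (pzf_step G B) \<subseteq> ?I" if "B \<in> ?I" for B
    using set_pmf_pzf_step[of B] that by auto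

  have AE_I: "AE \<omega> in pzf_process G S. \<omega> t \<in> ?I" for t
  proof (induction t)
    case 0
    have "(\<integral>\<^sup>+\<omega>. indicator (- ?I) (\<omega> 0) \<partial>pzf_process G S) = 0"
      using S by (simp add: nn_integral_pzf_process_0)
    then show ?case
      by (subst (asm) nn_integral_0_iff_AE) (auto split: split_indicator_asm)
  next
    case (Suc t)
    have "AE \<omega> in pzf_process G S. \<omega> t \<in> ?I \<longrightarrow> \<omega> (Suc t) \<in> ?I"
      using invariant by (intro AE_pzf_process_Suc AE_I2) blast
    with Suc show ?case
      by eventually_elim blast
  qed

  \<comment> \<open>Only unfinished states are charged a unit; at \<open>?V\<close> the deficit is
    already zero.\<close>
  have drift: "ennreal (\<phi> B) \<le> indicator (- {?V}) B + (\<integral>\<^sup>+B'. ennreal (\<phi> B') \<partial>pzf_step G B)"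
    if B: "B \<in> ?I" for B
  proof (cases "B = ?V")
    case True
    then show ?thesis by (simp add: \<phi>_def)
  next
    case False
    have int: "integrable (measure_pmf (pzf_step G B)) X" for X :: "_ \<Rightarrow> real"
      using B by (intro integrable_measure_pmf_finite finite_set_pmf_pzf_step) auto
    have "\<phi> B \<le> 1 + measure_pmf.expectation (pzf_step G B) \<phi>"
      using expectation_loglog_pzf_step[of B] B unfolding \<phi>_def[abs_def] by (simp add: int)
    moreover have AE: "AE B' in pzf_step G B. 0 \<le> \<phi> B'"
      using invariant[OF B] \<phi>_nonneg by (auto simp: AE_measure_pmf_iff)
    ultimately show ?thesis
      using False integral_nonneg_AE[OF AE]
      by (simp add: nn_integral_eq_integral[OF int AE] flip: ennreal_1 ennreal_plus)
  qed

  \<comment> \<open>Finiteness of \<open>p t\<close> lets summability and limits be handled over the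
    reals.\<close>
  have p_ennreal: "p t = ennreal (enn2real (p t))" for t
  proof -
    have "p t \<le> (\<integral>\<^sup>+\<omega>. 1 \<partial>pzf_process G S)"
      unfolding p_def by (intro nn_integral_mono) (auto split: split_indicator)
    then show ?thesis
      using prob_space.emeasure_space_1[OF prob_space_pzf_process, of G S] by (simp add: top.not_eq_extremum le_less_trans)
  qed

  have bound: "ennreal (\<phi> S) \<le> (\<Sum>t<m. p t) + (\<integral>\<^sup>+\<omega>. ennreal (\<phi> (\<omega> m)) \<partial>pzf_process G S)" for m
  proof (induction m)
    case 0
    show ?case
      using nn_integral_pzf_process_0[where g="\<lambda>B. ennreal (\<phi> B)"] by simp
  next
    case (Suc m)
    have "(\<integral>\<^sup>+\<omega>. ennreal (\<phi> (\<omega> m)) \<partial>pzf_process G S) \<le>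
        (\<integral>\<^sup>+\<omega>. indicator (- {?V}) (\<omega> m) + (\<integral>\<^sup>+B'. ennreal (\<phi> B') \<partial>pzf_step G (\<omega> m)) \<partial>pzf_process G S)"
      by (intro nn_integral_mono_AE, use AE_I[of m] in eventually_elim) (rule drift)
    also have "\<dots> = p m + (\<integral>\<^sup>+\<omega>. (\<integral>\<^sup>+B'. ennreal (\<phi> B') \<partial>pzf_step G (\<omega> m)) \<partial>pzf_process G S)"
      unfolding p_def by (rule nn_integral_add) (rule borel_measurable_pzf_process_component)+
    also have "(\<integral>\<^sup>+\<omega>. (\<integral>\<^sup>+B'. ennreal (\<phi> B') \<partial>pzf_step G (\<omega> m)) \<partial>pzf_process G S)
        = (\<integral>\<^sup>+\<omega>. ennreal (\<phi> (\<omega> (Suc m))) \<partial>pzf_process G S)"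
      using nn_integral_pzf_process_Suc[where h="\<lambda>_. 1" and n=m and g="\<lambda>B. ennreal (\<phi> B)"] by simp
    finally have "(\<integral>\<^sup>+\<omega>. ennreal (\<phi> (\<omega> m)) \<partial>pzf_process G S) \<le>
        p m + (\<integral>\<^sup>+\<omega>. ennreal (\<phi> (\<omega> (Suc m))) \<partial>pzf_process G S)" .
    from order_trans[OF Suc add_left_mono[OF this]] show ?case
      by (simp add: add.assoc)
  qed

  \<comment> \<open>The fully blue state is absorbing, so the number of unfinished times is at most
    any time at which \<open>?V\<close> is reached, hence at most the infimum of such times.\<close>
  have "AE \<omega> in pzf_process G S. \<forall>t. \<omega> t \<in> {?V} \<longrightarrow> \<omega> (Suc t) \<in> {?V}"
    unfolding AE_all_countable
    by (intro allI AE_pzf_process_Suc AE_I2) (use set_pmf_pzf_step[of ?V] in auto)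
  then have "(\<integral>\<^sup>+\<omega>. (\<Sum>t. indicator (- {?V}) (\<omega> t)) \<partial>pzf_process G S) \<le> ept_set G S"
    unfolding ept_set_def
  proof (intro nn_integral_mono_AE, eventually_elim)
    fix \<omega> :: "nat \<Rightarrow> 'a set"
    assume step: "\<forall>t. \<omega> t \<in> {?V} \<longrightarrow> \<omega> (Suc t) \<in> {?V}"
    show "(\<Sum>t. indicator (- {?V}) (\<omega> t)) \<le> propagation_time G \<omega>"
      unfolding propagation_time_def
    proof (rule INF_greatest, clarify)
      fix t assume t: "\<omega> t = ?V"
      have "\<omega> s = ?V" if "t \<le> s" for s
        using that by (induction rule: dec_induct) (use t step in auto)
      then have "(\<Sum>s. indicator (- {?V}) (\<omega> s)) = (\<Sum>s<t. indicator (- {?V}) (\<omega> s) :: ennreal)"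
        by (intro suminf_finite) (auto simp: not_less)
      also have "\<dots> \<le> (\<Sum>s<t. 1)"
        by (intro sum_mono) (auto split: split_indicator)
      finally show "(\<Sum>s. indicator (- {?V}) (\<omega> s)) \<le> (of_nat t :: ennreal)"
        by simp
    qed
  qed
  then have suminf_p: "(\<Sum>t. p t) \<le> ept_set G S"
    unfolding p_def by (subst (asm) nn_integral_suminf) (rule borel_measurable_pzf_process_component)
  \<comment> \<open>Finite expected time makes the series of \<open>p\<close> summable, so its terms
    tend to 0.\<close>
  then have "(\<Sum>t. ennreal (enn2real (p t))) \<noteq> top"
    using False by (auto simp: top_unique simp flip: p_ennreal)
  then have "summable (\<lambda>t. enn2real (p t))"
    by (intro summable_suminf_not_top) auto
  then have "(\<lambda>t. enn2real (p t)) \<longlonglongrightarrow> 0"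
    by (rule summable_LIMSEQ_zero)
  then have "(\<lambda>m. ept_set G S + ennreal (loglog ?n * enn2real (p m))) \<longlonglongrightarrow> ept_set G S + ennreal (loglog ?n * 0)"
    by (intro tendsto_add tendsto_ennrealI tendsto_mult tendsto_const)
  moreover have "ennreal (\<phi> S) \<le> ept_set G S + ennreal (loglog ?n * enn2real (p m))" for m
  proof -
    \<comment> \<open>The deficit never exceeds \<open>loglog ?n\<close> and vanishes at
      \<open>?V\<close>, so its mean at time \<open>m\<close> is at most \<open>loglog ?n\<close>
      times \<open>p m\<close>.\<close>
    have "(\<integral>\<^sup>+\<omega>. ennreal (\<phi> (\<omega> m)) \<partial>pzf_process G S) \<le>
        (\<integral>\<^sup>+\<omega>. ennreal (loglog ?n) * indicator (- {?V}) (\<omega> m) \<partial>pzf_process G S)"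
    proof (intro nn_integral_mono_AE, use AE_I[of m] in eventually_elim)
      fix \<omega> assume "\<omega> m \<in> ?I"
      from ennreal_leI[OF \<phi>_le[OF this]]
      show "ennreal (\<phi> (\<omega> m)) \<le> ennreal (loglog ?n) * indicator (- {?V}) (\<omega> m)"
        by (cases "\<omega> m = ?V") auto
    qed
    also have "\<dots> = ennreal (loglog ?n) * p m"
      unfolding p_def by (rule nn_integral_cmult) (rule borel_measurable_pzf_process_component)
    also have "\<dots> = ennreal (loglog ?n) * ennreal (enn2real (p m))"
      by (simp flip: p_ennreal)
    also have "\<dots> = ennreal (loglog ?n * enn2real (p m))"
      using card_ge[of S] S by (intro ennreal_mult[symmetric] loglog_nonneg) auto
    finally have tail: "(\<integral>\<^sup>+\<omega>. ennreal (\<phi> (\<omega> m)) \<partial>pzf_process G S) \<le> ennreal (loglog ?n * enn2real (p m))" .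
    have "(\<Sum>t<m. p t) \<le> (\<Sum>t. p t)"
      by (rule sum_le_suminf) auto
    from order_trans[OF this suminf_p] tail show ?thesis
      by (intro order_trans[OF bound[of m]] add_mono)
  qed
  ultimately have "ennreal (\<phi> S) \<le> ept_set G S + ennreal (loglog ?n * 0)"
    by (intro LIMSEQ_le_const) auto
  then show ?thesis
    by (simp add: \<phi>_def)
qed

theorem corollary4p14:
  fixes G :: "'a pair_pre_digraph"
  assumes "pair_graph G"
    and "Digraph_Component.connected (with_proj G)"
    and "card (pverts G) \<ge> 3"
  shows "th_pzf G \<ge> ennreal (log 2 (log 2 (2 * real (card (pverts G)))))
       \<and> ept G \<ge> ennreal (log 2 (log 2 (2 * real (card (pverts G)))))"
proof -
  let ?V = "pverts G"
  have fin: "finite ?V" and ne: "?V \<noteq> {}"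
    using assms(3) by (auto intro: card_ge_0_finite)
  \<comment> \<open>A singleton start has no head start, since \<open>loglog 1 = 0\<close>.\<close>
  have ept: "ennreal (loglog (real (card ?V))) \<le> ept_set G {v}" if "v \<in> ?V" for v
    using pair_graph.ept_set_ge[OF assms(1), of "{v}"] that by simp
  have th: "ennreal (loglog (real (card ?V))) \<le> of_nat (card S) + ept_set G S"
    if S: "S \<subseteq> ?V" "S \<noteq> {}" for S
  proof -
    have card: "1 \<le> card S" "card S \<le> card ?V"
      using S finite_subset[OF S(1)] fin by (auto simp: Suc_le_eq card_gt_0_iff card_mono)
    have "loglog (real (card ?V)) \<le> real (card S) + (loglog (real (card ?V)) - loglog (real (card S)))"
      using loglog_le_self[OF card(1)] by simp
    then have "ennreal (loglog (real (card ?V)))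
        \<le> ennreal (real (card S) + (loglog (real (card ?V)) - loglog (real (card S))))"
      by (rule ennreal_leI)
    \<comment> \<open>Splitting the sum in \<open>ennreal\<close> needs a nonnegative difference,
      which monotonicity of \<open>loglog\<close> supplies.\<close>
    also have "\<dots> = of_nat (card S) + ennreal (loglog (real (card ?V)) - loglog (real (card S)))"
      using loglog_mono[of "real (card S)" "real (card ?V)"] card
      by (subst ennreal_plus) (auto simp: ennreal_of_nat_eq_real_of_nat)
    also have "\<dots> \<le> of_nat (card S) + ept_set G S"
      by (intro add_left_mono pair_graph.ept_set_ge assms S)
    finally show ?thesis .
  qed
  have "ennreal (loglog (real (card ?V))) \<le> th_pzf G"
    unfolding th_pzf_def using fin ne th by (subst Min_ge_iff) auto
  moreover have "ennreal (loglog (real (card ?V))) \<le> ept G"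
    unfolding ept_def using fin ne ept by (subst Min_ge_iff) auto
  ultimately show ?thesis
    by (simp add: loglog_def)
qed

end
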